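(* Let $q$ be a prime power and let $n\geq 2$ be an integer. Let $\Psi:\mathcal{D}(n)\to\mathcal{M}_n$ be the map sending $(\delta_1,\dots,\delta_{n-1})$ to the Motzkin word $p_1\dots p_n$ where, with $\delta_0=\delta_n=0$, for every $1\leq i\leq n$, $$p_i=\begin{cases} U & \text{if } \delta_i-\delta_{i-1}=1,\\ H & \text{if } \delta_i-\delta_{i-1}=0,\\ D & \text{if } \delta_i-\delta_{i-1}=-1.\end{cases}$$ Then for every distance vector $v=(\delta_1,\dots,\delta_{n-1})\in\mathcal{D}(n)$ we have $A(\Psi(v))=\delta_1+\cdots+\delta_{n-1}$. In other words, $\Psi$ takes flag distance to area, and for every integer $d\in[0,\lfloor n^2/4\rfloor]$ the restriction $\Psi|_{\mathcal{D}(d,n)}:\mathcal{D}(d,n)\to\mathcal{M}_n(d)$ is a bijection.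
   Context: Let $\mathbb{F}_q$ be the finite field with $q$ elements. A full flag on $\mathbb{F}_q^n$ is a sequence $\mathcal{F}=(\mathcal{F}_1,\dots,\mathcal{F}_{n-1})$ of $\mathbb{F}_q$-subspaces of $\mathbb{F}_q^n$ with $\mathcal{F}_1\subsetneq\cdots\subsetneq\mathcal{F}_{n-1}$ and $\dim \mathcal{F}_i=i$ for every $i$; the set of all full flags is the full flag variety $\mathcal{F}_q(n)$. For subspaces $\mathcal{U},\mathcal{V}$ of the same dimension $k$, the injection distance is $d_I(\mathcal{U},\mathcal{V})=k-\dim(\mathcal{U}\cap\mathcal{V})$. The distance vector of $\mathcal{F},\mathcal{F}'\in\mathcal{F}_q(n)$ is $\mathbf{d}(\mathcal{F},\mathcal{F}')=(d_I(\mathcal{F}_1,\mathcal{F}'_1),\dots,d_I(\mathcal{F}_{n-1},\mathcal{F}'_{n-1}))\in\mathbb{Z}^{n-1}$; the flag distance $d_f(\mathcal{F},\mathcal{F}')=\sum_{i=1}^{n-1} d_I(\mathcal{F}_i,\mathcal{F}'_i)$ is the sum of its components. Put $\mathcal{D}(n)=\{\mathbf{d}(\mathcal{F},\mathcal{F}') \mid \mathcal{F},\mathcal{F}'\in\mathcal{F}_q(n)\}$ and $\mathcal{D}(d,n)=\{\mathbf{d}(\mathcal{F},\mathcal{F}') \mid \mathcal{F},\mathcal{F}'\in\mathcal{F}_q(n),\ d_f(\mathcal{F},\mathcal{F}')=d\}$ (pairs with $\mathcal{F}=\mathcal{F}'$ are allowed). A Motzkin path of length $n$ is a lattice path in $\mathbb{Z}^2$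 from $(0,0)$ to $(n,0)$ with steps $U=(1,1)$, $D=(1,-1)$, $H=(1,0)$ that never runs below the $x$-axis; $\mathcal{M}_n$ is the set of these, and a path is identified with its Motzkin word $p_1\dots p_n$ in the letters $U,D,H$. The area $A(p)$ of a Motzkin path $p$ is the area of the region above the $x$-axis and below $p$, and $\mathcal{M}_n(d)$ is the set of Motzkin paths of length $n$ and area $d$. (The map $\Psi$ is well defined: consecutive components of a distance vector, including $\delta_0=\delta_n=0$, differ by $-1$, $0$ or $1$, and the resulting word is a Motzkin word.) *)

theory Defs
  imports "HOL-Analysis.Analysis"
begin

text \<open>
  The space of \<open>n\<close>-tuples over the field with \<open>q\<close> elements is \<open>'a ^ 'n\<close>, where the field
  \<open>'a\<close> has \<open>CARD('a) = q\<close> and \<open>CARD('n) = n\<close>. Sequences indexed from 1 are lists, so the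
  entry with index \<open>i\<close> is found at list position \<open>i - 1\<close>.
\<close>

definition full_flags :: "('a::{field,finite} ^ 'n) set list set" where
  "full_flags =
    {F. length F = CARD('n) - 1 \<and>
        (\<forall>i\<in>{1..CARD('n) - 1}. vec.subspace (F ! (i - 1)) \<and> vec.dim (F ! (i - 1)) = i) \<and>
        (\<forall>i\<in>{1..<CARD('n) - 1}. F ! (i - 1) \<subset> F ! i)}"

text \<open>Only used for two subspaces of the same dimension.\<close>

definition injection_distance ::
    "('a::{field,finite} ^ 'n) set \<Rightarrow> ('a ^ 'n) set \<Rightarrow> int" where
  "injection_distance V W = int (vec.dim V) - int (vec.dim (V \<inter> W))"

definition distance_vector ::
    "('a::{field,finite} ^ 'n) set list \<Rightarrow> ('a ^ 'n) set list \<Rightarrow> int list" where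
  "distance_vector F F' =
    map (\<lambda>i. injection_distance (F ! (i - 1)) (F' ! (i - 1))) [1..<CARD('n)]"

definition flag_distance ::
    "('a::{field,finite} ^ 'n) set list \<Rightarrow> ('a ^ 'n) set list \<Rightarrow> int" where
  "flag_distance F F' =
    (\<Sum>i = 1..CARD('n) - 1. injection_distance (F ! (i - 1)) (F' ! (i - 1)))"

text \<open>
  The type argument, as in \<open>TYPE('a ^ 'n)\<close>, names the ambient space of the flags; it cannot
  be read off from the integer vectors.
\<close>

definition distance_vectors :: "('a::{field,finite} ^ 'n) itself \<Rightarrow> int list set" where
  "distance_vectors _ =
    {distance_vector F F' | F F' :: ('a ^ 'n) set list. F \<in> full_flags \<and> F' \<in> full_flags}"

definition distance_vectors_at ::
    "int \<Rightarrow> ('a::{field,finite} ^ 'n) itself \<Rightarrow> int list set" where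
  "distance_vectors_at d _ =
    {distance_vector F F' | F F' :: ('a ^ 'n) set list.
       F \<in> full_flags \<and> F' \<in> full_flags \<and> flag_distance F F' = d}"

datatype step = U | D | H

fun step_vec :: "step \<Rightarrow> int \<times> int" where
  "step_vec U = (1, 1)"
| "step_vec D = (1, -1)"
| "step_vec H = (1, 0)"

definition vertex :: "step list \<Rightarrow> nat \<Rightarrow> int \<times> int" where
  "vertex p i = (\<Sum>s\<leftarrow>take i p. step_vec s)"

text \<open>
  Since the steps are straight, a path stays weakly above the x-axis iff its vertices do.
\<close>

definition motzkin_paths :: "nat \<Rightarrow> step list set" where
  "motzkin_paths n =
    {p. vertex p (length p) = (int n, 0) \<and> (\<forall>i\<le>length p. 0 \<le> snd (vertex p i))}"

definition real_vertex :: "step list \<Rightarrow> nat \<Rightarrow> real \<times> real" where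
  "real_vertex p i = map_prod real_of_int real_of_int (vertex p i)"

definition path_curve :: "step list \<Rightarrow> (real \<times> real) set" where
  "path_curve p = (\<Union>i<length p. closed_segment (real_vertex p i) (real_vertex p (Suc i)))"

definition region_below :: "step list \<Rightarrow> (real \<times> real) set" where
  "region_below p = {(x, y). 0 \<le> y \<and> (\<exists>t. (x, t) \<in> path_curve p \<and> y \<le> t)}"

definition area :: "step list \<Rightarrow> real" where
  "area p = measure lborel (region_below p)"

definition motzkin_paths_area :: "nat \<Rightarrow> int \<Rightarrow> step list set" where
  "motzkin_paths_area n d = {p \<in> motzkin_paths n. area p = real_of_int d}"

text \<open>Differences other than 1, 0 and -1 do not occur between components of distance vectors.\<close>

definition step_of_diff :: "int \<Rightarrow> step" where
  "step_of_diff k =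
    (if k = 1 then U else if k = 0 then H else if k = -1 then D else undefined)"

text \<open>
  For a vector of length \<open>n - 1\<close>; in \<open>0 # v @ [0]\<close> position \<open>i\<close> carries the component with
  index \<open>i\<close>, for \<open>i\<close> from 0 to \<open>n\<close>, including the two conventional zeros at the ends.
\<close>

definition Psi :: "int list \<Rightarrow> step list" where
  "Psi v = (let \<delta> = 0 # v @ [0]
            in map (\<lambda>i. step_of_diff (\<delta> ! i - \<delta> ! (i - 1))) [1..<length v + 2])"

end

theory Submission
  imports Defs
begin

text \<open>
  By the dimension formula for sums of subspaces, \<open>dim (F i \<inter> F' i)\<close> grows by 0, 1 or 2 at each step, so consecutive
  components of a distance vector differ by at most 1, and they are the heights of the vertices of
  the associated path. The area is then a sum of trapezoids, whose mean heights add up to the sum of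
  the heights because the path starts and ends at height 0. Conversely, the heights of any Motzkin
  path are realised by two flags of coordinate subspaces, whose index sets are built up one element
  at a time: an up step adds two different fresh indices, a level step adds the same fresh index to
  both sets, and a down step adds to each set an index of the other one. Fresh indices are available
  since the path must return to height 0 within the remaining steps.
\<close>

subsection \<open>Heights of lattice paths\<close>

definition height :: "step list \<Rightarrow> nat \<Rightarrow> int" where
  "height p i = snd (vertex p i)"

lemma vertex_0 [simp]: "vertex p 0 = (0, 0)"
  by (simp add: vertex_def zero_prod_def)

lemma vertex_Suc: "i < length p \<Longrightarrow> vertex p (Suc i) = vertex p i + step_vec (p ! i)"
  by (simp add: vertex_def take_Suc_conv_app_nth)

lemma fst_step_vec [simp]: "fst (step_vec s) = 1"
  by (cases s) auto

lemma abs_snd_step_vec: "\<bar>snd (step_vec s)\<bar> \<le> 1"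
  by (cases s) auto

lemma step_of_diff_snd_step_vec [simp]: "step_of_diff (snd (step_vec s)) = s"
  by (cases s) (auto simp: step_of_diff_def)

lemma step_vec_step_of_diff: "\<bar>k\<bar> \<le> 1 \<Longrightarrow> step_vec (step_of_diff k) = (1, k)"
proof -
  assume "\<bar>k\<bar> \<le> 1"
  then have "k = -1 \<or> k = 0 \<or> k = 1" by arith
  then show ?thesis by (auto simp: step_of_diff_def)
qed

lemma height_0 [simp]: "height p 0 = 0"
  by (simp add: height_def)

lemma height_Suc: "i < length p \<Longrightarrow> height p (Suc i) = height p i + snd (step_vec (p ! i))"
  by (simp add: height_def vertex_Suc)

lemma vertex_eq: "i \<le> length p \<Longrightarrow> vertex p i = (int i, height p i)"
proof (induction i)
  case (Suc i)
  then show ?case by (simp add: vertex_Suc height_Suc prod_eq_iff)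
qed simp

lemma mem_motzkin_paths_iff:
  "p \<in> motzkin_paths n \<longleftrightarrow> length p = n \<and> height p n = 0 \<and> (\<forall>i\<le>n. 0 \<le> height p i)"
  by (auto simp: motzkin_paths_def vertex_eq)

text \<open>Each remaining step lowers the height by at most 1, and the end is at height 0; the
  induction runs backwards from \<open>n\<close>. This bound later guarantees enough fresh
  indices.\<close>

lemma height_le_remaining:
  assumes "p \<in> motzkin_paths n" "i \<le> n"
  shows "height p i \<le> int n - int i"
  using assms(2)
proof (induction rule: inc_induct)
  case base
  then show ?case using assms by (simp add: mem_motzkin_paths_iff)
next
  case (step i)
  then have "i < length p" using assms by (simp add: mem_motzkin_paths_iff)
  then show ?case using step.IH height_Suc[of i p] abs_snd_step_vec[of "p ! i"] by linarith
qed

subsection \<open>The area below a path\<close>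

text \<open>The region below a single step over the unit interval starting at \<open>k\<close>, with
  heights \<open>a\<close> and \<open>b\<close> at its ends.\<close>

definition trapezoid :: "real \<Rightarrow> real \<Rightarrow> real \<Rightarrow> (real \<times> real) set" where
  "trapezoid k a b = {(x, y). k \<le> x \<and> x \<le> k + 1 \<and> 0 \<le> y \<and> y \<le> a + (b - a) * (x - k)}"

lemma trapezoid_borel: "trapezoid k a b \<in> sets borel"
proof -
  have "closed (trapezoid k a b)"
    unfolding trapezoid_def case_prod_beta
    by (intro closed_Collect_conj closed_Collect_le continuous_intros)
  then show ?thesis by (rule borel_closed)
qed

text \<open>Integrates the lengths of the vertical slices; the slice at \<open>x\<close> is the
  interval from 0 to the linear function \<open>f x\<close>.\<close>

lemma emeasure_trapezoid:
  assumes "0 \<le> a" "0 \<le> b"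
  shows "emeasure lborel (trapezoid k a b) = ennreal ((a + b) / 2)"
proof -
  define f where "f x = a + (b - a) * (x - k)" for x
  \<comment> \<open>An antiderivative of \<open>f\<close> that vanishes at \<open>k\<close>.\<close>
  define F where "F x = a * (x - k) + (b - a) / 2 * (x - k)\<^sup>2" for x
  have f_nonneg: "0 \<le> f x" if "k \<le> x" "x \<le> k + 1" for x
  proof -
    \<comment> \<open>On the unit interval \<open>f x\<close> is a convex combination of
      \<open>a\<close> and \<open>b\<close>.\<close>
    have "f x = a * (1 - (x - k)) + b * (x - k)" by (simp add: f_def algebra_simps)
    then show ?thesis using assms that by simp
  qed
  have slice: "emeasure lborel (Pair x -` trapezoid k a b) = ennreal (f x) * indicator {k..k+1} x" for x
  proof (cases "x \<in> {k..k+1}")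
    case True
    then have "Pair x -` trapezoid k a b = {0..f x}"
      by (auto simp: trapezoid_def f_def)
    then show ?thesis using True f_nonneg by simp
  next
    case False
    then have "Pair x -` trapezoid k a b = {}"
      by (auto simp: trapezoid_def)
    then show ?thesis using False by simp
  qed
  have "emeasure lborel (trapezoid k a b) = (\<integral>\<^sup>+x. emeasure lborel (Pair x -` trapezoid k a b) \<partial>lborel)"
    unfolding lborel_prod[symmetric]
    by (rule lborel.emeasure_pair_measure_alt) (simp only: lborel_prod sets_lborel trapezoid_borel)
  also have "\<dots> = (\<integral>\<^sup>+x. ennreal (f x) * indicator {k..k+1} x \<partial>lborel)"
    by (simp add: slice)
  also have "\<dots> = ennreal (F (k + 1) - F k)"
  proof (rule nn_integral_FTC_Icc)
    show "f \<in> borel_measurable borel" unfolding f_def by measurable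
    show "DERIV F x :> f x" for x
      unfolding F_def f_def
      by (auto intro!: derivative_eq_intros simp: field_simps)
  qed (use f_nonneg in auto)
  also have "F (k + 1) - F k = (a + b) / 2"
    by (simp add: F_def field_simps)
  finally show ?thesis .
qed

lemma fmeasurable_trapezoid:
  "0 \<le> a \<Longrightarrow> 0 \<le> b \<Longrightarrow> trapezoid k a b \<in> fmeasurable lborel"
  by (auto intro!: fmeasurableI simp: trapezoid_borel emeasure_trapezoid)

text \<open>A vertical line has measure 0 times infinity, which is 0. Neighbouring trapezoids share
  only points of such a line.\<close>

lemma AE_lborel_fst_neq: "AE z in (lborel :: (real \<times> real) measure). fst z \<noteq> c"
proof (rule AE_I)
  have "emeasure (lborel \<Otimes>\<^sub>M lborel) ({c} \<times> (UNIV :: real set)) = 0"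
    by (subst lborel.emeasure_pair_measure_Times) auto
  then show "emeasure lborel ({c} \<times> (UNIV :: real set)) = 0"
    by (simp add: lborel_prod)
  show "{c} \<times> (UNIV :: real set) \<in> sets lborel"
    by (simp add: borel_closed closed_Times)
qed auto

text \<open>As the segment has horizontal extent 1, its parameter is \<open>x - k\<close>, so the
  segment is the graph of an affine function of \<open>x\<close>.\<close>

lemma mem_closed_segment_unit_step:
  "(x, t) \<in> closed_segment (k, a) (k + 1, b) \<longleftrightarrow>
     k \<le> x \<and> x \<le> k + 1 \<and> t = a + (b - a) * (x - (k::real))"
proof
  assume "(x, t) \<in> closed_segment (k, a) (k + 1, b)"
  then show "k \<le> x \<and> x \<le> k + 1 \<and> t = a + (b - a) * (x - k)"
    by (auto simp: closed_segment_def algebra_simps)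
next
  assume "k \<le> x \<and> x \<le> k + 1 \<and> t = a + (b - a) * (x - k)"
  then show "(x, t) \<in> closed_segment (k, a) (k + 1, b)"
    by (auto simp: closed_segment_def algebra_simps intro!: exI[of _ "x - k"])
qed

lemma region_below_eq:
  "region_below p = (\<Union>i<length p. trapezoid (real i) (height p i) (height p (Suc i)))"
proof -
  have "(x, t) \<in> closed_segment (real_vertex p i) (real_vertex p (Suc i)) \<longleftrightarrow>
      real i \<le> x \<and> x \<le> real i + 1 \<and>
      t = height p i + (height p (Suc i) - height p i) * (x - real i)"
    if "i < length p" for i x t
    using that mem_closed_segment_unit_step[of x t "real i" "height p i" "height p (Suc i)"]
    by (simp add: real_vertex_def vertex_eq add.commute)
  then have "(x, t) \<in> path_curve p \<longleftrightarrow>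
      (\<exists>i<length p. real i \<le> x \<and> x \<le> real i + 1 \<and>
         t = height p i + (height p (Suc i) - height p i) * (x - real i))" for x t
    by (auto simp: path_curve_def)
  then show ?thesis
    unfolding region_below_def trapezoid_def by fastforce
qed

lemma area_eq_sum_height:
  assumes "p \<in> motzkin_paths n"
  shows "area p = real_of_int (\<Sum>i<n. height p i)"
proof -
  have len: "length p = n" and end0: "height p n = 0"
    and nonneg: "\<And>i. i \<le> n \<Longrightarrow> 0 \<le> height p i"
    using assms by (auto simp: mem_motzkin_paths_iff)
  let ?T = "\<lambda>i. trapezoid (real i) (height p i) (height p (Suc i))"
  have "area p = measure lborel (\<Union>i\<in>{..<n}. ?T i)"
    by (simp add: area_def region_below_eq len)
  also have "\<dots> = (\<Sum>i<n. measure lborel (?T i))"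
  proof (rule measure_UNION_AE)
    show "?T i \<in> fmeasurable lborel" if "i \<in> {..<n}" for i
      using that by (intro fmeasurable_trapezoid) (auto simp: nonneg)
    show "pairwise (\<lambda>i j. AE z in lborel. z \<notin> ?T i \<or> z \<notin> ?T j) {..<n}"
    proof (rule pairwiseI)
      fix i j :: nat
      assume "i \<noteq> j"
      show "AE z in lborel. z \<notin> ?T i \<or> z \<notin> ?T j"
        \<comment> \<open>If \<open>i < j\<close>, a common point has
          \<open>x \<le> i + 1 \<le> j \<le> x\<close>, so its first coordinate is the larger
          index.\<close>
        using AE_lborel_fst_neq[of "real (max i j)"]
      proof eventually_elim
        case (elim z)
        with \<open>i \<noteq> j\<close> show ?case
          by (cases i j rule: linorder_cases) (auto simp: trapezoid_def max_def)
      qed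
    qed
  qed simp
  also have "\<dots> = (\<Sum>i<n. (real_of_int (height p i) + height p (Suc i)) / 2)"
    by (intro sum.cong) (auto simp: measure_def emeasure_trapezoid nonneg)
  also have "\<dots> = ((\<Sum>i<n. real_of_int (height p i)) + (\<Sum>i<n. real_of_int (height p (Suc i)))) / 2"
    by (simp add: sum_divide_distrib[symmetric] sum.distrib)
  \<comment> \<open>The shift drops the height at 0 and adds the height at \<open>n\<close>, and
    both are 0.\<close>
  also have "(\<Sum>i<n. real_of_int (height p (Suc i))) = (\<Sum>i<n. real_of_int (height p i))"
    using sum.lessThan_Suc_shift[of "\<lambda>i. real_of_int (height p i)" n] by (simp add: end0)
  finally show ?thesis by simp
qed

subsection \<open>Paths and their height vectors\<close>

text \<open>A description of the distance vectors without flags, shown to be exact in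
  \<open>distance_vectors_eq\<close>. The added zeros also bound the first and last entries by
  1.\<close>

definition motzkin_vectors :: "nat \<Rightarrow> int list set" where
  "motzkin_vectors n =
    {v. Suc (length v) = n \<and> (\<forall>x\<in>set v. 0 \<le> x) \<and>
        (\<forall>i<n. \<bar>(0 # v @ [0]) ! Suc i - (0 # v @ [0]) ! i\<bar> \<le> 1)}"

lemma length_Psi [simp]: "length (Psi v) = Suc (length v)"
  by (simp add: Psi_def Let_def del: upt_Suc)

lemma nth_Psi:
  "i \<le> length v \<Longrightarrow> Psi v ! i = step_of_diff ((0 # v @ [0]) ! Suc i - (0 # v @ [0]) ! i)"
  by (simp add: Psi_def Let_def del: upt_Suc)

text \<open>The differences telescope. Since they are bounded by 1, \<open>step_of_diff\<close>
  always returns the step with that vertical part. The vector can thus be read off the path, which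
  yields both the area formula and injectivity.\<close>

lemma height_Psi:
  assumes "v \<in> motzkin_vectors n" "i \<le> n"
  shows "height (Psi v) i = (0 # v @ [0]) ! i"
  using assms(2)
proof (induction i)
  case (Suc i)
  then show ?case
    using assms(1) by (simp add: height_Suc nth_Psi step_vec_step_of_diff motzkin_vectors_def)
qed simp

lemma Psi_in_motzkin_paths:
  assumes "v \<in> motzkin_vectors n"
  shows "Psi v \<in> motzkin_paths n"
proof -
  have "0 \<le> (0 # v @ [0]) ! i" if "i \<le> n" for i
  proof -
    have "(0 # v @ [0]) ! i \<in> set (0 # v @ [0])"
      using assms that by (intro nth_mem) (auto simp: motzkin_vectors_def)
    then show ?thesis using assms by (auto simp: motzkin_vectors_def)
  qed
  then show ?thesis
    using assms
    by (auto simp: mem_motzkin_paths_iff height_Psi motzkin_vectors_def nth_append)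
qed

lemma area_Psi:
  assumes "v \<in> motzkin_vectors n"
  shows "area (Psi v) = real_of_int (\<Sum>\<delta>\<leftarrow>v. \<delta>)"
proof -
  have n: "n = Suc (length v)" using assms by (simp add: motzkin_vectors_def)
  have "(\<Sum>i<n. height (Psi v) i) = (\<Sum>i<n. (0 # v @ [0]) ! i)"
    using assms by (intro sum.cong) (auto simp: height_Psi)
  also have "\<dots> = (\<Sum>i<length v. v ! i)"
    by (simp only: n sum.lessThan_Suc_shift) (simp add: nth_append)
  finally show ?thesis
    using area_eq_sum_height[OF Psi_in_motzkin_paths[OF assms]]
    by (simp add: sum_list_sum_nth atLeast0LessThan)
qed

lemma inj_on_Psi: "inj_on Psi (motzkin_vectors n)"
proof (rule inj_onI)
  fix v w assume vw: "v \<in> motzkin_vectors n" "w \<in> motzkin_vectors n" "Psi v = Psi w"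
  then have len: "length v = length w" "Suc (length v) = n" by (auto simp: motzkin_vectors_def)
  moreover have "v ! i = w ! i" if "i < length v" for i
    using height_Psi[OF vw(1), of "Suc i"] height_Psi[OF vw(2), of "Suc i"] vw(3) len that
    by (simp add: nth_append)
  ultimately show "v = w" by (auto intro: nth_equalityI)
qed

lemma nth_height_vector:
  assumes "p \<in> motzkin_paths n" "0 < n" "i \<le> n"
  shows "(0 # map (height p) [1..<n] @ [0]) ! i = height p i"
proof -
  consider "i = 0" | j where "i = Suc j" "Suc j < n" | "i = n" "0 < n"
    using assms by (metis le_neq_implies_less not0_implies_Suc neq0_conv)
  then show ?thesis
    using assms by cases (auto simp: nth_append mem_motzkin_paths_iff nth_Cons')
qed

text \<open>Surjectivity of \<open>Psi\<close>: the preimage of a path is the list of its heights at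
  the interior vertices.\<close>

lemma motzkin_vector_of_path:
  assumes "p \<in> motzkin_paths n" "0 < n"
  shows "map (height p) [1..<n] \<in> motzkin_vectors n" "Psi (map (height p) [1..<n]) = p"
proof -
  have diff: "(0 # map (height p) [1..<n] @ [0]) ! Suc i - (0 # map (height p) [1..<n] @ [0]) ! i
      = snd (step_vec (p ! i))" if "i < n" for i
    using assms that
    by (simp only: nth_height_vector Suc_le_eq less_imp_le) (simp add: height_Suc mem_motzkin_paths_iff)
  show "map (height p) [1..<n] \<in> motzkin_vectors n"
    unfolding motzkin_vectors_def mem_Collect_eq
  proof (intro conjI ballI allI impI)
    show "\<bar>(0 # map (height p) [1..<n] @ [0]) ! Suc i - (0 # map (height p) [1..<n] @ [0]) ! i\<bar> \<le> 1"
      if "i < n" for i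
      by (simp only: diff[OF that] abs_snd_step_vec)
  qed (use assms in \<open>auto simp: mem_motzkin_paths_iff\<close>)
  show "Psi (map (height p) [1..<n]) = p"
  proof (rule nth_equalityI)
    fix i assume "i < length (Psi (map (height p) [1..<n]))"
    then have "i < n" using assms by simp
    then show "Psi (map (height p) [1..<n]) ! i = p ! i"
      using assms by (subst nth_Psi) (simp, simp only: diff step_of_diff_snd_step_vec)
  qed (use assms in \<open>simp add: mem_motzkin_paths_iff\<close>)
qed

subsection \<open>Distance vectors are Motzkin vectors\<close>

text \<open>
  With the zero space at index 0 and the whole space at index \<open>n\<close>, the two conventional zeros of
  the distance vector become injection distances, too.
\<close>

definition flag_space :: "('a::{field,finite} ^ 'n) set list \<Rightarrow> nat \<Rightarrow> ('a ^ 'n) set" where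
  "flag_space F i = (if i = 0 then {0} else if i = CARD('n) then UNIV else F ! (i - 1))"

lemma flag_space:
  fixes F :: "('a::{field,finite} ^ 'n) set list"
  assumes "F \<in> full_flags" "i \<le> CARD('n)"
  shows "vec.subspace (flag_space F i)" "vec.dim (flag_space F i) = i"
  using assms
  by (auto simp: flag_space_def full_flags_def vec.subspace_0 vec_dim_card simp del: vec.dim_UNIV)

lemma flag_space_mono:
  fixes F :: "('a::{field,finite} ^ 'n) set list"
  assumes "F \<in> full_flags" "i < CARD('n)"
  shows "flag_space F i \<subseteq> flag_space F (Suc i)"
proof -
  have "0 \<in> flag_space F (Suc i)"
    using assms flag_space(1)[of F "Suc i"] by (simp add: vec.subspace_0)
  moreover have "F ! (i - 1) \<subset> F ! i" if "0 < i" "Suc i < CARD('n)"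
    using assms(1) that by (auto simp: full_flags_def)
  ultimately show ?thesis
    using assms by (auto simp: flag_space_def)
qed

text \<open>The sum of \<open>S\<close> and \<open>W\<close> lies in \<open>T\<close>, so the
  dimension formula gives the bound. When \<open>S\<close> is a hyperplane of \<open>T\<close>, it
  says that cutting \<open>W\<close> with \<open>S\<close> loses at most one dimension.\<close>

lemma dim_Int_codim:
  fixes S T W :: "('a::field ^ 'n) set"
  assumes "vec.subspace S" "vec.subspace W" "S \<subseteq> T" "W \<subseteq> T" "vec.subspace T"
  shows "vec.dim S + vec.dim W \<le> vec.dim (S \<inter> W) + vec.dim T"
proof -
  have "{x + y |x y. x \<in> S \<and> y \<in> W} \<subseteq> T"
    using assms by (auto intro: vec.subspace_add)
  then have "vec.dim {x + y |x y. x \<in> S \<and> y \<in> W} \<le> vec.dim T"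
    by (rule vec.dim_subset)
  then show ?thesis using vec.dim_sums_Int[OF assms(1,2)] by linarith
qed

lemma injection_distance_nonneg: "0 \<le> injection_distance V W"
  by (simp add: injection_distance_def vec.dim_subset)

text \<open>If the intersection grows by g dimensions, the injection distance changes by 1 - g; it
  remains to see that g is 0, 1 or 2.\<close>

lemma injection_distance_flag_space_step:
  fixes F F' :: "('a::{field,finite} ^ 'n) set list"
  assumes F: "F \<in> full_flags" and F': "F' \<in> full_flags" and i: "i < CARD('n)"
  shows "\<bar>injection_distance (flag_space F (Suc i)) (flag_space F' (Suc i)) -
          injection_distance (flag_space F i) (flag_space F' i)\<bar> \<le> 1"
proof -
  let ?S = "flag_space F" and ?S' = "flag_space F'"
  note sub = flag_space(1)[OF F] flag_space(1)[OF F']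
  note mono = flag_space_mono[OF F i] flag_space_mono[OF F' i]
  have "vec.dim (?S i \<inter> ?S' i) \<le> vec.dim (?S (Suc i) \<inter> ?S' (Suc i))"
    using mono by (intro vec.dim_subset) auto
  \<comment> \<open>The larger intersection is cut down in two stages, first with the hyperplane
    \<open>?S i\<close> of \<open>?S (Suc i)\<close>, then with the hyperplane \<open>?S' i\<close>
    of \<open>?S' (Suc i)\<close>.\<close>
  moreover have "vec.dim (?S i) + vec.dim (?S (Suc i) \<inter> ?S' (Suc i))
      \<le> vec.dim (?S i \<inter> (?S (Suc i) \<inter> ?S' (Suc i))) + vec.dim (?S (Suc i))"
    using mono i by (intro dim_Int_codim) (auto intro!: sub vec.subspace_inter)
  moreover have "vec.dim (?S' i) + vec.dim (?S i \<inter> ?S' (Suc i))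
      \<le> vec.dim (?S' i \<inter> (?S i \<inter> ?S' (Suc i))) + vec.dim (?S' (Suc i))"
    using mono i by (intro dim_Int_codim) (auto intro!: sub vec.subspace_inter)
  moreover have "?S i \<inter> (?S (Suc i) \<inter> ?S' (Suc i)) = ?S i \<inter> ?S' (Suc i)"
    "?S' i \<inter> (?S i \<inter> ?S' (Suc i)) = ?S i \<inter> ?S' i"
    using mono by auto
  ultimately show ?thesis
    using flag_space(2)[OF F] flag_space(2)[OF F'] i
    by (simp add: injection_distance_def)
qed

lemma nth_distance_vector:
  fixes F F' :: "('a::{field,finite} ^ 'n) set list"
  assumes "F \<in> full_flags" "F' \<in> full_flags" "i \<le> CARD('n)"
  shows "(0 # distance_vector F F' @ [0]) ! i =
    injection_distance (flag_space F i) (flag_space F' i)"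
proof -
  consider "i = 0" | j where "i = Suc j" "Suc j < CARD('n)" | "i = CARD('n)"
    using assms by (metis le_neq_implies_less not0_implies_Suc)
  then show ?thesis
    by cases
      (auto simp: distance_vector_def flag_space_def injection_distance_def nth_append nth_Cons')
qed

lemma distance_vector_in_motzkin_vectors:
  fixes F F' :: "('a::{field,finite} ^ 'n) set list"
  assumes "F \<in> full_flags" "F' \<in> full_flags"
  shows "distance_vector F F' \<in> motzkin_vectors (CARD('n))"
proof -
  have "\<bar>(0 # distance_vector F F' @ [0]) ! Suc i - (0 # distance_vector F F' @ [0]) ! i\<bar> \<le> 1"
    if "i < CARD('n)" for i
    using assms that injection_distance_flag_space_step[OF assms that]
    by (simp only: nth_distance_vector Suc_le_eq less_imp_le)
  then show ?thesis
    unfolding motzkin_vectors_def mem_Collect_eq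
    by (auto simp: distance_vector_def injection_distance_nonneg)
qed

lemma flag_distance_eq_sum_list:
  "flag_distance F F' = (\<Sum>\<delta>\<leftarrow>distance_vector F F'. \<delta>)"
proof -
  have "{1..n - 1} = {1..<n}" for n :: nat by auto
  then show ?thesis
    by (simp add: flag_distance_def distance_vector_def interv_sum_list_conv_sum_set_nat)
qed

subsection \<open>Every Motzkin vector is a distance vector\<close>

definition coordinate_subspace :: "'n set \<Rightarrow> ('a::field ^ 'n) set" where
  "coordinate_subspace A = {x. \<forall>i. i \<notin> A \<longrightarrow> x $ i = 0}"

lemma subspace_coordinate_subspace: "vec.subspace (coordinate_subspace A)"
  by (auto simp: coordinate_subspace_def vec.subspace_def)

lemma dim_coordinate_subspace: "vec.dim (coordinate_subspace A :: ('a::field ^ 'n) set) = card A"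
  by (simp add: coordinate_subspace_def dim_substandard_cart)

lemma coordinate_subspace_mono: "A \<subseteq> B \<Longrightarrow> coordinate_subspace A \<subseteq> coordinate_subspace B"
  by (auto simp: coordinate_subspace_def)

lemma coordinate_subspace_Int:
  "coordinate_subspace A \<inter> coordinate_subspace B = coordinate_subspace (A \<inter> B)"
  by (auto simp: coordinate_subspace_def)

definition coordinate_flag :: "(nat \<Rightarrow> 'n set) \<Rightarrow> ('a::{field,finite} ^ 'n) set list" where
  "coordinate_flag A = map (\<lambda>i. coordinate_subspace (A i)) [1..<CARD('n)]"

lemma coordinate_flag_in_full_flags:
  fixes A :: "nat \<Rightarrow> 'n::finite set"
  assumes card: "\<And>i. i \<le> CARD('n) \<Longrightarrow> card (A i) = i"
    and mono: "\<And>i. i < CARD('n) \<Longrightarrow> A i \<subseteq> A (Suc i)"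
  shows "(coordinate_flag A :: ('a::{field,finite} ^ 'n) set list) \<in> full_flags"
proof -
  let ?C = "\<lambda>i. coordinate_subspace (A i) :: ('a ^ 'n) set"
  have "?C i \<subset> ?C (Suc i)" if "i < CARD('n) - Suc 0" for i
  proof -
    \<comment> \<open>Strictness of the inclusion comes from the different dimensions.\<close>
    have "vec.dim (?C i) \<noteq> vec.dim (?C (Suc i))"
      using that by (simp add: dim_coordinate_subspace card)
    then have "?C i \<noteq> ?C (Suc i)" by metis
    then show ?thesis using coordinate_subspace_mono[OF mono[of i]] that by (simp add: psubset_eq less_diff_conv)
  qed
  moreover have "coordinate_flag A ! i = ?C (Suc i)" if "Suc i < CARD('n)" for i
    using that nth_upt[of 1 i "CARD('n)"] by (simp add: coordinate_flag_def)
  moreover from this have "coordinate_flag A ! (i - Suc 0) = ?C i" if "0 < i" "i < CARD('n)" for i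
    using that by (cases i) auto
  moreover have "length (coordinate_flag A :: ('a ^ 'n) set list) = CARD('n) - 1"
    by (simp add: coordinate_flag_def)
  \<comment> \<open>Subtraction on naturals is truncated, so this uses that \<open>CARD('n)\<close>
    is positive.\<close>
  moreover have "i < CARD('n)" if "i \<le> CARD('n) - Suc 0" for i
    using that zero_less_card_finite[where ?'a = 'n] by linarith
  moreover have "card (A i) = i" if "i \<le> CARD('n) - Suc 0" for i
    using that by (intro card) linarith
  ultimately show ?thesis
    by (simp add: full_flags_def Suc_le_eq less_diff_conv subspace_coordinate_subspace
        dim_coordinate_subspace)
qed

lemma injection_distance_coordinate_subspace:
  fixes A B :: "'n::finite set"
  shows "injection_distance (coordinate_subspace A :: ('a::{field,finite} ^ 'n) set)
    (coordinate_subspace B) = int (card (A - B))"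
proof -
  have "card (A \<inter> B) + card (A - B) = card A"
    by (metis card_Diff_subset_Int card_mono finite inf_le1 le_add_diff_inverse)
  then show ?thesis
    by (simp add: injection_distance_def coordinate_subspace_Int dim_coordinate_subspace)
qed

section \<open>Chains of index sets with prescribed differences\<close>

text \<open>Index sets of two coordinate subspaces of dimension \<open>i\<close> at injection
  distance \<open>h\<close>. They form a pair so that one choice function can build both
  chains.\<close>

definition offset_pair :: "nat \<Rightarrow> int \<Rightarrow> 'n set \<times> 'n set \<Rightarrow> bool" where
  "offset_pair i h = (\<lambda>(A, B). card A = i \<and> card B = i \<and> int (card (A - B)) = h)"

text \<open>The upper bound on \<open>h + k\<close> provides the fresh indices for up and level
  steps; its nonnegativity provides the indices to exchange in a down step.\<close>

lemma offset_pair_step: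
  fixes A B :: "'n::finite set"
  assumes AB: "offset_pair i h (A, B)" and k: "\<bar>k\<bar> \<le> 1" and "0 \<le> h + k"
    and le: "h + k \<le> int CARD('n) - int (Suc i)"
  shows "\<exists>A' B'. offset_pair (Suc i) (h + k) (A', B') \<and> A \<subseteq> A' \<and> B \<subseteq> B'"
proof -
  have cards: "card A = i" "card B = i" and h: "int (card (A - B)) = h"
    using AB by (auto simp: offset_pair_def)
  \<comment> \<open>Sets of equal size have differences of equal size.\<close>
  have h': "int (card (B - A)) = h"
    using cards h by (simp add: card_Diff_subset_Int Int_commute)
  have "card (A \<union> B) = card B + card (A - B)"
    by (subst Un_Diff_cancel2[symmetric]) (subst Un_commute, rule card_Un_disjoint, auto)
  \<comment> \<open>The union has \<open>i + h\<close> elements. By \<open>le\<close>, at least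
    \<open>k + 1\<close> indices lie outside it: two for an up step, one for a level step.\<close>
  then have "int (card (- (A \<union> B))) = int CARD('n) - int i - h"
    using card_mono[of UNIV "A \<union> B"] cards h by (simp add: Compl_eq_Diff_UNIV card_Diff_subset of_nat_diff)
  then have fresh: "int (card (- (A \<union> B))) \<ge> k + 1"
    using le by simp
  consider "k = 1" | "k = 0" | "k = -1" using k by arith
  then show ?thesis
  proof cases
    case 1
    then have "2 \<le> card (- (A \<union> B))" using fresh by simp
    then obtain x y where xy: "x \<noteq> y" "x \<notin> A \<union> B" "y \<notin> A \<union> B"
      by (meson ComplD card_2_iff' ex_card subset_eq)
    then have "insert x A - insert y B = insert x (A - B)" by auto
    then have "offset_pair (Suc i) (h + k) (insert x A, insert y B)"
      using xy cards h 1 by (simp add: offset_pair_def)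
    then show ?thesis by blast
  next
    case 2
    then have "- (A \<union> B) \<noteq> {}" using fresh by (metis add_0 card.empty of_nat_0 not_one_le_zero)
    then obtain x where x: "x \<notin> A \<union> B" by auto
    then have "insert x A - insert x B = A - B" by auto
    then have "offset_pair (Suc i) (h + k) (insert x A, insert x B)"
      using x cards h 2 by (simp add: offset_pair_def)
    then show ?thesis by blast
  next
    case 3
    then have "0 < card (A - B)" "0 < card (B - A)"
      using \<open>0 \<le> h + k\<close> h h' by linarith+
    then have "A - B \<noteq> {}" "B - A \<noteq> {}"
      unfolding card_gt_0_iff by blast+
    then obtain x y where xy: "x \<in> A - B" "y \<in> B - A" by blast
    \<comment> \<open>The index \<open>y\<close> was already in \<open>B\<close>, so it adds nothing
      to the difference, while \<open>x\<close> leaves it.\<close>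
    then have "insert y A - insert x B = A - B - {x}" by auto
    then have "int (card (insert y A - insert x B)) = h + k"
      using xy h 3 \<open>0 < card (A - B)\<close> by (simp add: card_Diff_singleton of_nat_diff)
    then have "offset_pair (Suc i) (h + k) (insert y A, insert x B)"
      using xy cards by (simp add: offset_pair_def)
    then show ?thesis by blast
  qed
qed

text \<open>Dependent choice, with \<open>offset_pair_step\<close> extending both sets along each
  step of the path.\<close>

lemma exists_offset_chains:
  assumes p: "p \<in> motzkin_paths (CARD('n::finite))"
  obtains A B :: "nat \<Rightarrow> 'n::finite set"
  where "\<And>i. i \<le> CARD('n) \<Longrightarrow> offset_pair i (height p i) (A i, B i)"
    and "\<And>i. i < CARD('n) \<Longrightarrow> A i \<subseteq> A (Suc i)"
    and "\<And>i. i < CARD('n) \<Longrightarrow> B i \<subseteq> B (Suc i)"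
proof -
  \<comment> \<open>The guards make both conditions vacuous beyond \<open>CARD('n)\<close>, so the
    choice can run over all naturals.\<close>
  let ?P = "\<lambda>i AB. i \<le> CARD('n) \<longrightarrow> offset_pair i (height p i) AB"
  let ?Q = "\<lambda>i AB AB'. i < CARD('n) \<longrightarrow> fst AB \<subseteq> fst AB' \<and> snd AB \<subseteq> (snd AB' :: 'n set)"
  have "\<exists>f :: nat \<Rightarrow> 'n set \<times> 'n set. \<forall>i. ?P i (f i) \<and> ?Q i (f i) (f (Suc i))"
  proof (rule dependent_nat_choice)
    show "\<exists>AB :: 'n set \<times> 'n set. ?P 0 AB"
      by (auto simp: offset_pair_def intro!: exI[of _ "{}"])
    fix AB :: "'n set \<times> 'n set" and i
    assume AB: "?P i AB"
    show "\<exists>AB'. ?P (Suc i) AB' \<and> ?Q i AB AB'"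
    proof (cases "i < CARD('n)")
      case True
      then have Suc: "height p (Suc i) = height p i + snd (step_vec (p ! i))"
        using p by (simp add: height_Suc mem_motzkin_paths_iff)
      obtain A B where [simp]: "AB = (A, B)" by (cases AB)
      have "\<exists>A' B'. offset_pair (Suc i) (height p i + snd (step_vec (p ! i))) (A', B') \<and> A \<subseteq> A' \<and> B \<subseteq> B'"
      proof (rule offset_pair_step)
        show "offset_pair i (height p i) (A, B)" using AB True by simp
        show "0 \<le> height p i + snd (step_vec (p ! i))"
          using p True unfolding Suc[symmetric] by (simp add: mem_motzkin_paths_iff Suc_le_eq)
        show "height p i + snd (step_vec (p ! i)) \<le> int CARD('n) - int (Suc i)"
          using height_le_remaining[OF p, of "Suc i"] True Suc by simp
      qed (rule abs_snd_step_vec)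
      then show ?thesis by (auto simp: Suc)
    qed auto
  qed
  then obtain f :: "nat \<Rightarrow> 'n set \<times> 'n set" where "\<And>i. ?P i (f i) \<and> ?Q i (f i) (f (Suc i))"
    by blast
  then show thesis
    by (intro that[of "fst \<circ> f" "snd \<circ> f"]) auto
qed

text \<open>The two chains give coordinate flags, and the injection distance of their members is the
  size of the set difference, which was arranged to be the height.\<close>

lemma height_vector_is_distance_vector:
  assumes p: "p \<in> motzkin_paths (CARD('n::finite))"
  shows "map (height p) [1..<CARD('n)] \<in> distance_vectors TYPE('a::{field,finite} ^ 'n::finite)"
proof -
  obtain A B :: "nat \<Rightarrow> 'n set"
    where AB: "\<And>i. i \<le> CARD('n) \<Longrightarrow> offset_pair i (height p i) (A i, B i)"
      and mono: "\<And>i. i < CARD('n) \<Longrightarrow> A i \<subseteq> A (Suc i)" "\<And>i. i < CARD('n) \<Longrightarrow> B i \<subseteq> B (Suc i)"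
    using exists_offset_chains[OF p] by blast
  let ?F = "coordinate_flag A :: ('a ^ 'n) set list"
  let ?F' = "coordinate_flag B :: ('a ^ 'n) set list"
  have "?F \<in> full_flags" "?F' \<in> full_flags"
    using AB by (auto intro!: coordinate_flag_in_full_flags mono simp: offset_pair_def)
  moreover have "distance_vector ?F ?F' = map (height p) [1..<CARD('n)]"
    using AB
    by (auto simp: distance_vector_def coordinate_flag_def injection_distance_coordinate_subspace
        offset_pair_def)
  ultimately show ?thesis
    unfolding distance_vectors_def mem_Collect_eq by metis
qed

section \<open>The set of distance vectors and the bijection\<close>

text \<open>For the harder inclusion, the path \<open>Psi v\<close> has a realisable height vector
  with the same image under \<open>Psi\<close>; by injectivity that vector is \<open>v\<close>. The
  right-hand side involves only \<open>n\<close>, so the set does not depend on the field.\<close>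

lemma distance_vectors_eq:
  "distance_vectors TYPE('a::{field,finite} ^ 'n::finite) = motzkin_vectors (CARD('n))"
proof (intro equalityI subsetI)
  fix v assume "v \<in> distance_vectors TYPE('a ^ 'n)"
  then show "v \<in> motzkin_vectors (CARD('n))"
    by (auto simp: distance_vectors_def distance_vector_in_motzkin_vectors)
next
  fix v assume v: "v \<in> motzkin_vectors (CARD('n))"
  let ?w = "map (height (Psi v)) [1..<CARD('n)]"
  have "?w \<in> motzkin_vectors (CARD('n))" "Psi ?w = Psi v"
    using motzkin_vector_of_path[OF Psi_in_motzkin_paths[OF v]] by auto
  then have "?w = v" using v inj_on_Psi by (metis inj_onD)
  then show "v \<in> distance_vectors TYPE('a ^ 'n)"
    using height_vector_is_distance_vector[OF Psi_in_motzkin_paths[OF v], where ?'a = 'a] by simp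
qed

lemma distance_vectors_at_eq:
  "distance_vectors_at d TYPE('a::{field,finite} ^ 'n::finite) =
    {v \<in> motzkin_vectors (CARD('n)). (\<Sum>\<delta>\<leftarrow>v. \<delta>) = d}"
  unfolding distance_vectors_eq[where ?'a = 'a, symmetric]
  by (auto simp: distance_vectors_at_def distance_vectors_def flag_distance_eq_sum_list)

theorem theorem4p14:
  fixes q n :: nat
  assumes "CARD('a::{field,finite}) = q" and "CARD('n::finite) = n" and "n \<ge> 2"
  shows "(Psi \<in> distance_vectors TYPE('a ^ 'n) \<rightarrow> motzkin_paths n) \<and>
    (\<forall>v \<in> distance_vectors TYPE('a ^ 'n). area (Psi v) = real_of_int (\<Sum>\<delta>\<leftarrow>v. \<delta>)) \<and>
    (\<forall>F \<in> full_flags. \<forall>F' \<in> (full_flags :: ('a ^ 'n) set list set).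
           area (Psi (distance_vector F F')) = real_of_int (flag_distance F F')) \<and>
    (\<forall>d::int. 0 \<le> d \<and> d \<le> \<lfloor>(real n)\<^sup>2 / 4\<rfloor> \<longrightarrow>
           bij_betw Psi (distance_vectors_at d TYPE('a ^ 'n)) (motzkin_paths_area n d))"
proof (intro conjI ballI allI impI)
  note n = assms(2)
  show "Psi \<in> distance_vectors TYPE('a ^ 'n) \<rightarrow> motzkin_paths n"
    by (auto simp: distance_vectors_eq n Psi_in_motzkin_paths)
  show "area (Psi v) = real_of_int (\<Sum>\<delta>\<leftarrow>v. \<delta>)" if "v \<in> distance_vectors TYPE('a ^ 'n)" for v
    using that area_Psi by (simp add: distance_vectors_eq)
  show "area (Psi (distance_vector F F')) = real_of_int (flag_distance F F')"
    if "F \<in> full_flags" "F' \<in> full_flags" for F F' :: "('a ^ 'n) set list"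
    using area_Psi[OF distance_vector_in_motzkin_vectors[OF that]]
    by (simp add: flag_distance_eq_sum_list)
  fix d :: int
  show "bij_betw Psi (distance_vectors_at d TYPE('a ^ 'n)) (motzkin_paths_area n d)"
  proof (rule bij_betw_imageI)
    show "inj_on Psi (distance_vectors_at d TYPE('a ^ 'n))"
      by (rule inj_on_subset[OF inj_on_Psi[of n]]) (auto simp: distance_vectors_at_eq n)
    show "Psi ` distance_vectors_at d TYPE('a ^ 'n) = motzkin_paths_area n d"
    proof (intro equalityI subsetI)
      fix p assume "p \<in> Psi ` distance_vectors_at d TYPE('a ^ 'n)"
      then show "p \<in> motzkin_paths_area n d"
        by (auto simp: distance_vectors_at_eq n motzkin_paths_area_def Psi_in_motzkin_paths area_Psi)
    next
      fix p assume "p \<in> motzkin_paths_area n d"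
      then have p: "p \<in> motzkin_paths n" "area p = real_of_int d"
        by (auto simp: motzkin_paths_area_def)
      \<comment> \<open>The heights of \<open>p\<close> at its interior vertices are the preimage;
        their sum is the area of \<open>p\<close>, so they have flag distance
        \<open>d\<close>.\<close>
      let ?v = "map (height p) [1..<n]"
      have v: "?v \<in> motzkin_vectors n" "Psi ?v = p"
        using motzkin_vector_of_path[OF p(1)] assms(3) by auto
      have "(\<Sum>\<delta>\<leftarrow>?v. \<delta>) = d"
        using area_Psi[OF v(1)] v(2) p(2) by simp
      then show "p \<in> Psi ` distance_vectors_at d TYPE('a ^ 'n)"
        using v by (auto simp: distance_vectors_at_eq n intro!: image_eqI[of _ _ ?v])
    qed
  qed
qed

end
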